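(* Let $\alpha,\beta>0$ and let $(B^*_t)_{t\ge0}$ be the bipartite multigraph process with parameters $\alpha,\beta$ on finite disjoint parts $\mathcal L,\mathcal R$. For any $t\ge0$ and any bi-degree sequence $(\boldsymbol D_{\mathcal L},\boldsymbol D_{\mathcal R})$ (with $\sum_{u\in\mathcal L}d_u=\sum_{v\in\mathcal R}d_v=t$, so that the conditioning event has positive probability), the bipartite multigraph $B^*_t$ conditioned on having bi-degree sequence $(\boldsymbol D_{\mathcal L},\boldsymbol D_{\mathcal R})$ has the same distribution as the bipartite configuration model $\mathrm{BCM}(\boldsymbol D_{\mathcal L},\boldsymbol D_{\mathcal R})$.
   Context: Multigraph process: $B^*_0$ is the graph on $V=\mathcal L\cup\mathcal R$ with no edges. Given $B^*_t$, one samples a pair $\{u,v\}$, $u\in\mathcal L$, $v\in\mathcal R$ (repetitions allowed), with probability $$\frac{(d_u(t)+\alpha)(d_v(t)+\beta)}{\sum_{x\in\mathcal L,\,y\in\mathcal R}(d_x(t)+\alpha)(d_y(t)+\beta)},$$ where $d_w(t)$ is the degree of $w$ in $B^*_t$ (with multiplicity), and adds the edge $\{u,v\}$ to obtain $B^*_{t+1}$. Bi-degree sequence: a pair $\boldsymbol D_{\mathcal L}=(d_u)_{u\in\mathcal L}$, $\boldsymbol D_{\mathcal R}=(d_v)_{v\in\mathcal R}$ of non-negative integer sequences with $\sum_{u\in\mathcal L}d_u=\sum_{v\in\mathcal R}d_v$; a bipartite multigraph on $V$ has this bi-degree sequence if every $w\in V$ has degree $d_w$. Bipartite configuration model $\mathrm{BCM}(\boldsymbol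 D_{\mathcal L},\boldsymbol D_{\mathcal R})$: attach to each vertex $w\in V$ a set $H_w$ of $d_w$ half-edges; take a uniformly random perfect matching (bijective pairing) between the left half-edges $\bigcup_{u\in\mathcal L}H_u$ and the right half-edges $\bigcup_{v\in\mathcal R}H_v$; the number of edges between $u\in\mathcal L$ and $v\in\mathcal R$ is the number of matched pairs consisting of a half-edge of $u$ and a half-edge of $v$. Multigraphs are regarded as labelled vertices with edge multiplicities (edges are not labelled). *)

theory Defs
  imports "HOL-Probability.Probability" "HOL-Library.Multiset" "HOL-Library.FuncSet"
begin

text \<open>
  A bipartite multigraph with parts \<open>L\<close> and \<open>R\<close> is the multiset of its edges \<open>(u, v)\<close>, where
  \<open>u \<in> L\<close> and \<open>v \<in> R\<close>: vertices are labelled, edges only carry multiplicities.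
\<close>

type_synonym 'v bigraph = "('v \<times> 'v) multiset"

definition deg :: "'v bigraph \<Rightarrow> 'v \<Rightarrow> nat" where
  "deg B w = size {#e \<in># B. fst e = w \<or> snd e = w#}"

definition edge_weight :: "real \<Rightarrow> real \<Rightarrow> 'v bigraph \<Rightarrow> 'v \<Rightarrow> 'v \<Rightarrow> real" where
  "edge_weight \<alpha> \<beta> B u v = (real (deg B u) + \<alpha>) * (real (deg B v) + \<beta>)"

text \<open>
  The use of \<open>embed_pmf\<close> is justified by \<open>pmf_edge_pmf\<close> below; if \<open>L\<close> or \<open>R\<close> is empty there is no
  pair to sample and the value is irrelevant.
\<close>

definition edge_pmf ::
    "'v set \<Rightarrow> 'v set \<Rightarrow> real \<Rightarrow> real \<Rightarrow> 'v bigraph \<Rightarrow> ('v \<times> 'v) pmf" where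
  "edge_pmf L R \<alpha> \<beta> B = embed_pmf (\<lambda>(u, v).
     if u \<in> L \<and> v \<in> R
     then edge_weight \<alpha> \<beta> B u v / (\<Sum>x\<in>L. \<Sum>y\<in>R. edge_weight \<alpha> \<beta> B x y)
     else 0)"

text \<open>The law of \<open>B\<^sup>*\<^sub>t\<close>, the time-\<open>t\<close> marginal of the Markov chain.\<close>

primrec process_pmf ::
    "'v set \<Rightarrow> 'v set \<Rightarrow> real \<Rightarrow> real \<Rightarrow> nat \<Rightarrow> 'v bigraph pmf" where
  "process_pmf L R \<alpha> \<beta> 0 = return_pmf {#}"
| "process_pmf L R \<alpha> \<beta> (Suc t) =
     bind_pmf (process_pmf L R \<alpha> \<beta> t)
       (\<lambda>B. map_pmf (\<lambda>e. add_mset e B) (edge_pmf L R \<alpha> \<beta> B))"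

definition bidegree_seq ::
    "'v set \<Rightarrow> 'v set \<Rightarrow> ('v \<Rightarrow> nat) \<Rightarrow> ('v \<Rightarrow> nat) \<Rightarrow> bool" where
  "bidegree_seq L R dL dR \<longleftrightarrow> (\<Sum>u\<in>L. dL u) = (\<Sum>v\<in>R. dR v)"

definition has_bidegree ::
    "'v set \<Rightarrow> 'v set \<Rightarrow> ('v \<Rightarrow> nat) \<Rightarrow> ('v \<Rightarrow> nat) \<Rightarrow> 'v bigraph \<Rightarrow> bool" where
  "has_bidegree L R dL dR B \<longleftrightarrow> (\<forall>u\<in>L. deg B u = dL u) \<and> (\<forall>v\<in>R. deg B v = dR v)"

definition half_edges :: "'v set \<Rightarrow> ('v \<Rightarrow> nat) \<Rightarrow> ('v \<times> nat) set" where
  "half_edges W d = (SIGMA w:W. {..<d w})"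

text \<open>
  A perfect matching is given by the bijection sending each left half-edge to its partner;
  extensionality makes the correspondence one-to-one.
\<close>

definition perfect_matchings ::
    "('v \<times> nat) set \<Rightarrow> ('v \<times> nat) set \<Rightarrow> ('v \<times> nat \<Rightarrow> 'v \<times> nat) set" where
  "perfect_matchings HL HR = {f \<in> HL \<rightarrow>\<^sub>E HR. bij_betw f HL HR}"

definition matching_graph ::
    "('v \<times> nat) set \<Rightarrow> ('v \<times> nat \<Rightarrow> 'v \<times> nat) \<Rightarrow> 'v bigraph" where
  "matching_graph HL f = image_mset (\<lambda>h. (fst h, fst (f h))) (mset_set HL)"

definition BCM ::
    "'v set \<Rightarrow> 'v set \<Rightarrow> ('v \<Rightarrow> nat) \<Rightarrow> ('v \<Rightarrow> nat) \<Rightarrow> 'v bigraph pmf" where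
  "BCM L R dL dR =
     map_pmf (matching_graph (half_edges L dL))
       (pmf_of_set (perfect_matchings (half_edges L dL) (half_edges R dR)))"

lemma pmf_edge_pmf:
  fixes \<alpha> \<beta> :: real
  assumes "finite L" "finite R" "L \<noteq> {}" "R \<noteq> {}" "\<alpha> > 0" "\<beta> > 0"
  shows "pmf (edge_pmf L R \<alpha> \<beta> B) (u, v) =
    (if u \<in> L \<and> v \<in> R
     then edge_weight \<alpha> \<beta> B u v / (\<Sum>x\<in>L. \<Sum>y\<in>R. edge_weight \<alpha> \<beta> B x y)
     else 0)"
proof -
  define S where "S = (\<Sum>x\<in>L. \<Sum>y\<in>R. edge_weight \<alpha> \<beta> B x y)"
  define p where "p = (\<lambda>(u, v). if u \<in> L \<and> v \<in> R then edge_weight \<alpha> \<beta> B u v / S else 0)"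
  have w: "edge_weight \<alpha> \<beta> B x y > 0" for x y
    using assms by (auto simp: edge_weight_def intro!: mult_pos_pos add_nonneg_pos)
  have S: "S > 0"
    unfolding S_def using assms w by (intro sum_pos) auto
  have nn: "p e \<ge> 0" for e
    using w S by (auto simp: p_def less_imp_le split: prod.splits)
  have "(\<Sum>e\<in>L \<times> R. p e) = (\<Sum>(x, y)\<in>L \<times> R. edge_weight \<alpha> \<beta> B x y / S)"
    by (intro sum.cong) (auto simp: p_def)
  also have "\<dots> = (\<Sum>x\<in>L. \<Sum>y\<in>R. edge_weight \<alpha> \<beta> B x y) / S"
    by (simp add: sum.cartesian_product [symmetric] sum_divide_distrib)
  also have "\<dots> = 1"
    using S by (simp add: S_def)
  finally have one: "(\<Sum>e\<in>L \<times> R. p e) = 1" .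
  have "(\<integral>\<^sup>+e. ennreal (p e) \<partial>count_space UNIV) = (\<integral>\<^sup>+e. ennreal (p e) \<partial>count_space (L \<times> R))"
    by (intro nn_integral_count_space_eq) (auto simp: p_def split: if_splits)
  also have "\<dots> = (\<Sum>e\<in>L \<times> R. ennreal (p e))"
    using assms by (intro nn_integral_count_space_finite) auto
  also have "\<dots> = ennreal (\<Sum>e\<in>L \<times> R. p e)"
    using nn by (intro sum_ennreal) auto
  finally have "(\<integral>\<^sup>+e. ennreal (p e) \<partial>count_space UNIV) = 1"
    using one by simp
  hence "pmf (embed_pmf p) (u, v) = p (u, v)"
    using nn by (intro pmf_embed_pmf) auto
  thus ?thesis
    unfolding edge_pmf_def p_def S_def prod.case .
qed

end

(* For a multigraph B with t edges, the law of the process gives B a probability of the form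
   c * (product over vertices of rising factorials of the degrees) / (product of m_e! over edges
   with multiplicities m_e), and exactly (product of d_w! over vertices) / (product of m_e!) of
   the t! perfect matchings of half-edges produce B.  On the event that the degrees are
   prescribed both laws are therefore proportional to 1 / (product of m_e!), so conditioning
   identifies them. *)
theory Submission
  imports Defs
begin

section \<open>Counting matchings with prescribed labels\<close>

text \<open>On the vertex labels of the half-edges this is the product of the \<open>d_w!\<close>,
  on a multigraph the product of the factorials of its edge multiplicities. It is real-valued
  because it occurs in quotients.\<close>

definition mfact :: "'a multiset \<Rightarrow> real" where
  "mfact A = (\<Prod>x\<in>set_mset A. fact (count A x))"

lemma mfact_empty [simp]: "mfact {#} = 1"
  by (simp add: mfact_def)

lemma mfact_pos: "mfact A > 0"
  by (auto simp: mfact_def intro!: prod_pos)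

lemma mfact_superset:
  assumes "finite S" "set_mset A \<subseteq> S"
  shows "mfact A = (\<Prod>x\<in>S. fact (count A x))"
  unfolding mfact_def using assms
  by (intro prod.mono_neutral_left) (auto simp: not_in_iff)

lemma mfact_add_mset: "mfact (add_mset x A) = real (Suc (count A x)) * mfact A"
proof -
  let ?S = "insert x (set_mset A)"
  have "mfact (add_mset x A) = (\<Prod>y\<in>?S. fact (count (add_mset x A) y))"
    by (intro mfact_superset) auto
  also have "\<dots> = fact (Suc (count A x)) * (\<Prod>y\<in>?S - {x}. fact (count (add_mset x A) y))"
    by (subst prod.remove[of _ x]) auto
  also have "(\<Prod>y\<in>?S - {x}. fact (count (add_mset x A) y)) = (\<Prod>y\<in>?S - {x}. fact (count A y))"
    by (intro prod.cong) auto
  also have "fact (Suc (count A x)) * \<dots> = real (Suc (count A x)) * (\<Prod>y\<in>?S. fact (count A y))"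
    by (subst (2) prod.remove[of _ x]) auto
  also have "(\<Prod>y\<in>?S. fact (count A y)) = mfact A"
    by (intro mfact_superset[symmetric]) auto
  finally show ?thesis .
qed

lemma mfact_remove:
  assumes "x \<in># A"
  shows "mfact A = real (count A x) * mfact (A - {#x#})"
  using mfact_add_mset[of x "A - {#x#}"] assms by simp

text \<open>Groups the half-edges of \<open>Y\<close> by their label, since the summand depends on
  \<open>y\<close> only through \<open>b y\<close>.\<close>

lemma sum_image_mset_count:
  fixes g :: "'b \<Rightarrow> real"
  assumes "finite Y"
  shows "(\<Sum>y\<in>Y. g (b y)) = (\<Sum>v\<in>b ` Y. real (count (image_mset b (mset_set Y)) v) * g v)"
proof -
  have "(\<Sum>y\<in>Y. g (b y)) = (\<Sum>v\<in>b ` Y. \<Sum>y | y \<in> Y \<and> b y = v. g (b y))"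
    by (rule sum.image_gen[OF assms])
  also have "\<dots> = (\<Sum>v\<in>b ` Y. real (count (image_mset b (mset_set Y)) v) * g v)"
  proof (rule sum.cong[OF refl])
    fix v
    have "(\<Sum>x | x \<in> Y \<and> v = b x. count (mset_set Y) x) = (\<Sum>x | x \<in> Y \<and> b x = v. 1)"
      by (rule sum.cong) (use assms in auto)
    then show "(\<Sum>y | y \<in> Y \<and> b y = v. g (b y)) =
        real (count (image_mset b (mset_set Y)) v) * g v"
      using assms by (simp add: count_image_mset')
  qed
  finally show ?thesis .
qed

lemma sum_count_pairs:
  assumes "finite V" "snd ` set_mset B \<subseteq> V"
  shows "(\<Sum>v\<in>V. count B (u, v)) = count (image_mset fst B) u"
proof -
  have "count (image_mset fst B) u = (\<Sum>e | e \<in># B \<and> u = fst e. count B e)"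
    by (rule count_image_mset')
  also have "\<dots> = (\<Sum>e\<in>Pair u ` V. count B e)"
    using assms by (intro sum.mono_neutral_left) (force simp: not_in_iff)+
  also have "\<dots> = (\<Sum>v\<in>V. count B (u, v))"
    by (subst sum.reindex) (auto simp: inj_on_def)
  finally show ?thesis by simp
qed

text \<open>With \<open>a = b = fst\<close> on half-edges these are the perfect matchings that
  produce \<open>B\<close>. Arbitrary labelled sets replace half-edges so that an induction may
  remove one element at a time.\<close>

definition labelled_matchings ::
    "('x \<Rightarrow> 'a) \<Rightarrow> ('y \<Rightarrow> 'b) \<Rightarrow> 'x set \<Rightarrow> 'y set \<Rightarrow> ('a \<times> 'b) multiset \<Rightarrow> ('x \<Rightarrow> 'y) set" where
  "labelled_matchings a b X Y B = {f \<in> X \<rightarrow>\<^sub>E Y. bij_betw f X Y \<and>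
     image_mset (\<lambda>x. (a x, b (f x))) (mset_set X) = B}"

lemma finite_labelled_matchings:
  "finite X \<Longrightarrow> finite Y \<Longrightarrow> finite (labelled_matchings a b X Y B)"
  unfolding labelled_matchings_def
  by (rule finite_subset[of _ "X \<rightarrow>\<^sub>E Y"]) (auto intro: finite_PiE)

text \<open>Deleting the pair of \<open>x\<close> and \<open>y\<close> is a bijection onto the
  matchings of the remaining elements that realise \<open>B\<close> less one copy of the edge.
  Without such a copy in \<open>B\<close>, no matching can pair \<open>x\<close> with
  \<open>y\<close>.\<close>

lemma card_labelled_matchings_fixed:
  assumes "finite X" "x \<notin> X" "y \<in> Y"
  shows "card {f \<in> labelled_matchings a b (insert x X) Y B. f x = y} =
    (if (a x, b y) \<in># B then card (labelled_matchings a b X (Y - {y}) (B - {#(a x, b y)#})) else 0)"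
proof -
  let ?F = "{f \<in> labelled_matchings a b (insert x X) Y B. f x = y}"
  let ?G = "labelled_matchings a b X (Y - {y}) (B - {#(a x, b y)#})"
  have mset: "image_mset (\<lambda>z. (a z, b ((g(x := w)) z))) (mset_set X) =
      image_mset (\<lambda>z. (a z, b (g z))) (mset_set X)" for g w
    by (rule image_mset_cong) (use assms in auto)
  show ?thesis
  proof (cases "(a x, b y) \<in># B")
    case True
    \<comment> \<open>Resetting the value at \<open>x\<close> to \<open>undefined\<close> makes the
      restricted function extensional on \<open>X\<close>.\<close>
    have "bij_betw (\<lambda>f. f(x := undefined)) ?F ?G"
    proof (rule bij_betw_byWitness[where f' = "\<lambda>g. g(x := y)"])
      show "\<forall>f\<in>?F. (f(x := undefined))(x := y) = f"
        by (auto simp: fun_eq_iff)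
      show "\<forall>g\<in>?G. (g(x := y))(x := undefined) = g"
        using assms by (auto simp: fun_eq_iff labelled_matchings_def PiE_def extensional_def)
      show "(\<lambda>f. f(x := undefined)) ` ?F \<subseteq> ?G"
      proof safe
        fix f assume f: "f \<in> labelled_matchings a b (insert x X) Y B" and y: "y = f x"
        have bij: "bij_betw f (insert x X) Y"
          using f by (simp add: labelled_matchings_def)
        have "bij_betw f X (Y - {f x})"
          using bij assms(2) by (auto simp: bij_betw_def) (metis imageI)
        then have bij': "bij_betw (f(x := undefined)) X (Y - {f x})"
          using assms(2) by (subst bij_betw_cong[of X _ f]) auto
        have "add_mset (a x, b (f x)) (image_mset (\<lambda>z. (a z, b (f z))) (mset_set X)) = B"
          using f assms by (simp add: labelled_matchings_def)
        then have "image_mset (\<lambda>z. (a z, b ((f(x := undefined)) z))) (mset_set X) =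
            B - {#(a x, b (f x))#}"
          unfolding mset by auto
        moreover have "f(x := undefined) \<in> X \<rightarrow>\<^sub>E Y - {f x}"
          using bij' f assms(2)
          by (auto simp: PiE_def bij_betw_def extensional_def labelled_matchings_def)
        ultimately show "f(x := undefined) \<in> labelled_matchings a b X (Y - {f x}) (B - {#(a x, b (f x))#})"
          using bij' by (simp add: labelled_matchings_def)
      qed
      show "(\<lambda>g. g(x := y)) ` ?G \<subseteq> ?F"
      proof safe
        fix g assume g: "g \<in> ?G"
        have "bij_betw (g(x := y)) X (Y - {y})"
          using g assms(2) by (subst bij_betw_cong[of X _ g]) (auto simp: labelled_matchings_def)
        then have bij: "bij_betw (g(x := y)) (insert x X) Y"
          using notIn_Un_bij_betw[of x X "g(x := y)" "Y - {y}"] assms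
          by (auto simp: insert_absorb)
        have "image_mset (\<lambda>z. (a z, b ((g(x := y)) z))) (mset_set (insert x X)) =
            add_mset (a x, b y) (image_mset (\<lambda>z. (a z, b (g z))) (mset_set X))"
          using assms mset[of g y] by simp
        also have "\<dots> = B"
          using g True by (simp add: labelled_matchings_def)
        finally show "g(x := y) \<in> labelled_matchings a b (insert x X) Y B"
          using bij g assms by (auto simp: labelled_matchings_def PiE_def extensional_def)
      qed simp
    qed
    then show ?thesis
      using True by (simp add: bij_betw_same_card)
  next
    case False
    then have "?F = {}"
      using assms by (auto simp: labelled_matchings_def)
    then show ?thesis
      unfolding \<open>?F = {}\<close> using False by simp
  qed
qed

text \<open>Induction on the left elements, splitting the matchings by the partner of the new
  element \<open>x\<close>. The marginal hypotheses say that \<open>B\<close> has the degrees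
  dictated by the labels, and they survive the removal of a pair together with its edge.\<close>

lemma card_labelled_matchings:
  fixes a :: "'x \<Rightarrow> 'a" and b :: "'y \<Rightarrow> 'b"
  assumes "finite X" "finite Y"
    and "image_mset fst B = image_mset a (mset_set X)"
    and "image_mset snd B = image_mset b (mset_set Y)"
  shows "real (card (labelled_matchings a b X Y B)) =
    mfact (image_mset a (mset_set X)) * mfact (image_mset b (mset_set Y)) / mfact B"
  using assms
proof (induction X arbitrary: Y B rule: finite_induct)
  case empty
  then have "B = {#}" "Y = {}"
    by (auto simp: mset_set_empty_iff)
  then have "labelled_matchings a b {} Y B = {\<lambda>_. undefined}"
    by (auto simp: labelled_matchings_def bij_betw_def)
  with \<open>B = {#}\<close> \<open>Y = {}\<close> show ?case by simp
next
  case (insert x X)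
  let ?M = "labelled_matchings a b (insert x X) Y B"
  define A where "A = image_mset a (mset_set (insert x X))"
  define C where "C = image_mset b (mset_set Y)"
  define P where "P = mfact A * mfact C / mfact B"
  \<comment> \<open>\<open>g v\<close> is the number of matchings that pair \<open>x\<close> with
    one given element labelled \<open>v\<close>. Removing the pair strips one multiplicity from each
    \<open>mfact\<close> in the claimed value \<open>P\<close>: \<open>count A (a x)\<close> and
    \<open>count C v\<close> from the numerator, \<open>count B (a x, v)\<close> from the
    denominator.\<close>
  define g where "g v = P * real (count B (a x, v)) / (real (count A (a x)) * real (count C v))" for v
  have ax: "a x \<in># A" "A - {#a x#} = image_mset a (mset_set X)"
    using insert.hyps by (auto simp: A_def)
  have step: "real (card {f \<in> ?M. f x = y}) = g (b y)" if y: "y \<in> Y" for y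
  proof (cases "(a x, b y) \<in># B")
    case True
    have C': "C - {#b y#} = image_mset b (mset_set (Y - {y}))" "b y \<in># C"
      using y insert.prems(1) by (auto simp: C_def mset_set_Diff image_mset_Diff)
    have "real (card (labelled_matchings a b X (Y - {y}) (B - {#(a x, b y)#}))) =
        mfact (A - {#a x#}) * mfact (C - {#b y#}) / mfact (B - {#(a x, b y)#})"
      unfolding ax(2) C'(1)
    proof (rule insert.IH)
      show "image_mset fst (B - {#(a x, b y)#}) = image_mset a (mset_set X)"
        using True insert.prems(2) insert.hyps by (simp add: image_mset_Diff)
      show "image_mset snd (B - {#(a x, b y)#}) = image_mset b (mset_set (Y - {y}))"
        using True insert.prems(3) C' by (simp add: image_mset_Diff C_def)
    qed (use insert.prems in auto)
    also have "\<dots> = g (b y)"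
      using ax C' True mfact_pos[of "B - {#(a x, b y)#}"]
      by (simp add: g_def count_eq_zero_iff P_def mfact_remove[of "a x" A] mfact_remove[of "b y" C]
          mfact_remove[of "(a x, b y)" B] field_simps)
    finally show ?thesis
      using True card_labelled_matchings_fixed[OF insert.hyps y, of a b B] by simp
  next
    case False
    then show ?thesis
      using card_labelled_matchings_fixed[OF insert.hyps y, of a b B] by (simp add: g_def count_eq_zero_iff)
  qed
  have "?M = (\<Union>y\<in>Y. {f \<in> ?M. f x = y})"
    by (auto simp: labelled_matchings_def)
  then have "card ?M = card (\<Union>y\<in>Y. {f \<in> ?M. f x = y})"
    by simp
  also have "\<dots> = (\<Sum>y\<in>Y. card {f \<in> ?M. f x = y})"
    using insert finite_labelled_matchings[of "insert x X" Y a b B]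
    by (intro card_UN_disjoint) auto
  finally have "real (card ?M) = (\<Sum>y\<in>Y. real (card {f \<in> ?M. f x = y}))"
    by simp
  also have "\<dots> = (\<Sum>y\<in>Y. g (b y))"
    by (rule sum.cong) (use step in auto)
  also have "\<dots> = (\<Sum>v\<in>b ` Y. real (count C v) * g v)"
    using insert.prems(1) by (simp add: sum_image_mset_count[of Y g b] C_def)
  \<comment> \<open>The \<open>count C v\<close> possible partners with label \<open>v\<close>
    cancel the same factor in the denominator of \<open>g v\<close>. What remains sums the edges of
    \<open>B\<close> at \<open>a x\<close>, of which there are \<open>count A (a x)\<close>.\<close>
  also have "\<dots> = (\<Sum>v\<in>b ` Y. P / real (count A (a x)) * real (count B (a x, v)))"
  proof (rule sum.cong[OF refl])
    fix v assume "v \<in> b ` Y"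
    then have "count C v \<noteq> 0"
      using insert.prems(1) by (simp add: C_def)
    then show "real (count C v) * g v = P / real (count A (a x)) * real (count B (a x, v))"
      by (simp add: g_def)
  qed
  also have "\<dots> = P / real (count A (a x)) * real (\<Sum>v\<in>b ` Y. count B (a x, v))"
    by (simp add: sum_distrib_left)
  also have "(\<Sum>v\<in>b ` Y. count B (a x, v)) = count A (a x)"
  proof (subst sum_count_pairs)
    have "set_mset (image_mset snd B) = b ` Y"
      using insert.prems by simp
    then show "snd ` set_mset B \<subseteq> b ` Y"
      by simp
  qed (use insert.prems in \<open>auto simp: A_def\<close>)
  also have "P / real (count A (a x)) * real (count A (a x)) = P"
    using ax by simp
  finally show ?case
    unfolding P_def A_def C_def .
qed

section \<open>The law of the process\<close>

lemma deg_empty [simp]: "deg {#} w = 0"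
  by (simp add: deg_def)

lemma deg_add_mset: "deg (add_mset e B) w = deg B w + (if fst e = w \<or> snd e = w then 1 else 0)"
  by (simp add: deg_def)

text \<open>\<open>deg\<close> counts edges incident at either end; as the parts are disjoint, a
  left vertex occurs only as a first component.\<close>

lemma deg_left:
  assumes "set_mset B \<subseteq> L \<times> R" "L \<inter> R = {}" "u \<in> L"
  shows "deg B u = count (image_mset fst B) u"
  using assms by (induction B) (auto simp: deg_add_mset)

lemma deg_right:
  assumes "set_mset B \<subseteq> L \<times> R" "L \<inter> R = {}" "v \<in> R"
  shows "deg B v = count (image_mset snd B) v"
  using assms by (induction B) (auto simp: deg_add_mset)

lemma sum_deg_left:
  assumes "finite L" "set_mset B \<subseteq> L \<times> R" "L \<inter> R = {}"
  shows "(\<Sum>u\<in>L. deg B u) = size B"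
proof -
  have "(\<Sum>u\<in>L. deg B u) = (\<Sum>u\<in>L. count (image_mset fst B) u)"
    by (rule sum.cong) (use deg_left[OF assms(2,3)] in auto)
  also have "\<dots> = (\<Sum>u\<in>set_mset (image_mset fst B). count (image_mset fst B) u)"
    using assms by (intro sum.mono_neutral_right) (auto simp: not_in_iff[symmetric])
  also have "\<dots> = size B"
    by (metis size_image_mset size_multiset_overloaded_eq)
  finally show ?thesis .
qed

lemma sum_deg_right:
  assumes "finite R" "set_mset B \<subseteq> L \<times> R" "L \<inter> R = {}"
  shows "(\<Sum>v\<in>R. deg B v) = size B"
proof -
  have "(\<Sum>v\<in>R. deg B v) = (\<Sum>v\<in>R. count (image_mset snd B) v)"
    by (rule sum.cong) (use deg_right[OF assms(2,3)] in auto)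
  also have "\<dots> = (\<Sum>v\<in>set_mset (image_mset snd B). count (image_mset snd B) v)"
    using assms by (intro sum.mono_neutral_right) (auto simp: not_in_iff[symmetric])
  also have "\<dots> = size B"
    by (metis size_image_mset size_multiset_overloaded_eq)
  finally show ?thesis .
qed

text \<open>The double sum factors, and each part has total degree \<open>size B\<close>. Hence the
  normalisation of a step depends on the multigraph only through its number of edges.\<close>

lemma sum_edge_weight:
  assumes "finite L" "finite R" "set_mset B \<subseteq> L \<times> R" "L \<inter> R = {}"
  shows "(\<Sum>x\<in>L. \<Sum>y\<in>R. edge_weight \<alpha> \<beta> B x y) =
    (real (size B) + real (card L) * \<alpha>) * (real (size B) + real (card R) * \<beta>)"
proof -
  have "(\<Sum>x\<in>L. real (deg B x) + \<alpha>) = real (size B) + real (card L) * \<alpha>"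
    using sum_deg_left[OF assms(1,3,4)] by (simp add: sum.distrib flip: of_nat_sum)
  moreover have "(\<Sum>y\<in>R. real (deg B y) + \<beta>) = real (size B) + real (card R) * \<beta>"
    using sum_deg_right[OF assms(2,3,4)] by (simp add: sum.distrib flip: of_nat_sum)
  ultimately show ?thesis
    by (simp add: edge_weight_def flip: sum_product)
qed

text \<open>The accumulated attachment weights: a left vertex that reaches degree \<open>d\<close>
  contributes \<alpha>(\<alpha> + 1)...(\<alpha> + d - 1), whenever its edges arrive. The parts have
  separate degree functions so that both \<open>deg B\<close> and the prescribed \<open>dL\<close>,
  \<open>dR\<close> fit.\<close>

definition degree_weight ::
    "'v set \<Rightarrow> 'v set \<Rightarrow> real \<Rightarrow> real \<Rightarrow> ('v \<Rightarrow> nat) \<Rightarrow> ('v \<Rightarrow> nat) \<Rightarrow> real" where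
  "degree_weight L R \<alpha> \<beta> dL dR =
     (\<Prod>u\<in>L. pochhammer \<alpha> (dL u)) * (\<Prod>v\<in>R. pochhammer \<beta> (dR v))"

lemma degree_weight_pos: "\<alpha> > 0 \<Longrightarrow> \<beta> > 0 \<Longrightarrow> degree_weight L R \<alpha> \<beta> dL dR > 0"
  unfolding degree_weight_def by (intro mult_pos_pos prod_pos) (auto intro: pochhammer_pos)

lemma prod_pochhammer_upd:
  fixes c :: real
  assumes "finite V" "w \<in> V" "d' w = Suc (d w)" "\<And>z. z \<in> V \<Longrightarrow> z \<noteq> w \<Longrightarrow> d' z = d z"
  shows "(\<Prod>z\<in>V. pochhammer c (d' z)) = (real (d w) + c) * (\<Prod>z\<in>V. pochhammer c (d z))"
proof -
  have "(\<Prod>z\<in>V - {w}. pochhammer c (d' z)) = (\<Prod>z\<in>V - {w}. pochhammer c (d z))"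
    by (rule prod.cong) (use assms in auto)
  then show ?thesis
    using assms by (simp add: prod.remove[of V w] pochhammer_Suc algebra_simps)
qed

lemma degree_weight_add_mset:
  assumes "finite L" "finite R" "L \<inter> R = {}" "u \<in> L" "v \<in> R"
  shows "degree_weight L R \<alpha> \<beta> (deg (add_mset (u, v) B)) (deg (add_mset (u, v) B)) =
    edge_weight \<alpha> \<beta> B u v * degree_weight L R \<alpha> \<beta> (deg B) (deg B)"
proof -
  have "(\<Prod>z\<in>L. pochhammer \<alpha> (deg (add_mset (u, v) B) z)) =
      (real (deg B u) + \<alpha>) * (\<Prod>z\<in>L. pochhammer \<alpha> (deg B z))"
    using assms by (intro prod_pochhammer_upd) (auto simp: deg_add_mset)
  moreover have "(\<Prod>z\<in>R. pochhammer \<beta> (deg (add_mset (u, v) B) z)) =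
      (real (deg B v) + \<beta>) * (\<Prod>z\<in>R. pochhammer \<beta> (deg B z))"
    using assms by (intro prod_pochhammer_upd) (auto simp: deg_add_mset)
  ultimately show ?thesis
    by (simp add: degree_weight_def edge_weight_def)
qed

text \<open>The last edge added must be one of the edges of \<open>B\<close>. The sum runs over the
  distinct edges, since equal copies leave the same predecessor.\<close>

lemma pmf_bind_add_mset:
  "pmf (bind_pmf p (\<lambda>B. map_pmf (\<lambda>e. add_mset e B) (q B))) B =
    (\<Sum>e\<in>set_mset B. pmf p (B - {#e#}) * pmf (q (B - {#e#})) e)"
proof -
  let ?h = "\<lambda>B'. pmf (map_pmf (\<lambda>e. add_mset e B') (q B')) B"
  have inj: "inj_on (\<lambda>e. B - {#e#}) (set_mset B)"
    by (intro inj_onI) (metis insert_DiffM add_mset_add_single add_left_imp_eq single_eq_single)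
  have "pmf (bind_pmf p (\<lambda>B. map_pmf (\<lambda>e. add_mset e B) (q B))) B =
      (\<integral>B'. ?h B' \<partial>measure_pmf p)"
    by (rule pmf_bind)
  \<comment> \<open>Only the finitely many multigraphs \<open>B - {#e#}\<close> can lead to
    \<open>B\<close>, so the integral is a finite sum.\<close>
  also have "\<dots> = (\<Sum>B'\<in>(\<lambda>e. B - {#e#}) ` set_mset B. ?h B' * pmf p B')"
  proof (rule integral_measure_pmf_real)
    fix B' assume "?h B' \<noteq> 0"
    then have "B \<in> set_pmf (map_pmf (\<lambda>e. add_mset e B') (q B'))"
      unfolding set_pmf_iff .
    then show "B' \<in> (\<lambda>e. B - {#e#}) ` set_mset B"
      by force
  qed simp
  also have "\<dots> = (\<Sum>e\<in>set_mset B. ?h (B - {#e#}) * pmf p (B - {#e#}))"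
    by (simp add: sum.reindex[OF inj])
  also have "\<dots> = (\<Sum>e\<in>set_mset B. pmf p (B - {#e#}) * pmf (q (B - {#e#})) e)"
  proof (rule sum.cong[OF refl])
    fix e assume e: "e \<in># B"
    have "?h (B - {#e#}) = pmf (q (B - {#e#})) e"
      using e pmf_map_inj'[of "\<lambda>e'. add_mset e' (B - {#e#})" "q (B - {#e#})" e]
      by (simp add: inj_def)
    then show "?h (B - {#e#}) * pmf p (B - {#e#}) = pmf p (B - {#e#}) * pmf (q (B - {#e#})) e"
      by simp
  qed
  finally show ?thesis .
qed

text \<open>The denominator collects the normalisations of the steps \<open>s < t\<close>. Together
  with \<open>mfact B\<close>, the factor \<open>fact t\<close> counts the orders in which the edges
  of \<open>B\<close> can arrive.\<close>

definition process_const :: "'v set \<Rightarrow> 'v set \<Rightarrow> real \<Rightarrow> real \<Rightarrow> nat \<Rightarrow> real" where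
  "process_const L R \<alpha> \<beta> t =
     fact t / (\<Prod>s<t. (real s + real (card L) * \<alpha>) * (real s + real (card R) * \<beta>))"

lemma process_const_pos:
  assumes "finite L" "finite R" "\<alpha> > 0" "\<beta> > 0" "t = 0 \<or> L \<noteq> {} \<and> R \<noteq> {}"
  shows "process_const L R \<alpha> \<beta> t > 0"
  unfolding process_const_def using assms
  by (intro divide_pos_pos prod_pos) (auto intro!: mult_pos_pos add_nonneg_pos simp: card_gt_0_iff)

text \<open>Every order of arrival of the edges of \<open>B\<close> has the same probability, and
  there are \<open>fact t / mfact B\<close> orders; the induction removes the last edge. For
  positive \<open>t\<close> both parts have to be nonempty for \<open>edge_pmf\<close> to be
  meaningful.\<close>

lemma pmf_process:
  assumes "finite L" "finite R" "L \<inter> R = {}" "\<alpha> > 0" "\<beta> > 0"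
    and "t = 0 \<or> L \<noteq> {} \<and> R \<noteq> {}"
  shows "pmf (process_pmf L R \<alpha> \<beta> t) B =
    (if size B = t \<and> set_mset B \<subseteq> L \<times> R
     then process_const L R \<alpha> \<beta> t * degree_weight L R \<alpha> \<beta> (deg B) (deg B) / mfact B else 0)"
  using assms(6)
proof (induction t arbitrary: B)
  case 0
  then show ?case
    by (auto simp: process_const_def degree_weight_def)
next
  case (Suc t)
  then have ne: "L \<noteq> {}" "R \<noteq> {}" by auto
  let ?Z = "(real t + real (card L) * \<alpha>) * (real t + real (card R) * \<beta>)"
  let ?W = "degree_weight L R \<alpha> \<beta> (deg B) (deg B)"
  have const: "process_const L R \<alpha> \<beta> (Suc t) = real (Suc t) * process_const L R \<alpha> \<beta> t / ?Z"
    by (simp add: process_const_def)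
  let ?p = "\<lambda>e. pmf (process_pmf L R \<alpha> \<beta> t) (B - {#e#}) * pmf (edge_pmf L R \<alpha> \<beta> (B - {#e#})) e"
  have sum: "pmf (process_pmf L R \<alpha> \<beta> (Suc t)) B = (\<Sum>e\<in>set_mset B. ?p e)"
    by (simp add: pmf_bind_add_mset)
  show ?case
  proof (cases "size B = Suc t \<and> set_mset B \<subseteq> L \<times> R")
    case True
    \<comment> \<open>Removing \<open>e\<close> divides \<open>mfact B\<close> by
      \<open>count B e\<close>, so each predecessor contributes in proportion to this multiplicity.
      The multiplicities add up to \<open>Suc t\<close>, which turns \<open>fact t\<close> into
      \<open>fact (Suc t)\<close>.\<close>
    have "?p e = process_const L R \<alpha> \<beta> t * ?W / (mfact B * ?Z) * real (count B e)"
      if e: "e \<in># B" for e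
    proof -
      obtain u v where uv: "e = (u, v)" "u \<in> L" "v \<in> R"
        using e True by auto
      let ?B = "B - {#e#}"
      have B: "B = add_mset e ?B" "size ?B = t" "set_mset ?B \<subseteq> L \<times> R"
        using e True by (auto simp: size_Diff_singleton dest: in_diffD)
      have W: "?W = edge_weight \<alpha> \<beta> ?B u v * degree_weight L R \<alpha> \<beta> (deg ?B) (deg ?B)"
        using degree_weight_add_mset[OF assms(1-3) uv(2,3), of \<alpha> \<beta> ?B] B(1) uv(1) by simp
      have "pmf (edge_pmf L R \<alpha> \<beta> ?B) e = edge_weight \<alpha> \<beta> ?B u v / ?Z"
        using pmf_edge_pmf[OF assms(1,2) ne assms(4,5), of ?B u v]
          sum_edge_weight[OF assms(1,2) B(3) assms(3), of \<alpha> \<beta>] uv B(2) by simp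
      moreover have "pmf (process_pmf L R \<alpha> \<beta> t) ?B =
          process_const L R \<alpha> \<beta> t * degree_weight L R \<alpha> \<beta> (deg ?B) (deg ?B) / mfact ?B"
        using Suc.IH[of ?B] ne B(2,3) by simp
      ultimately show ?thesis
        using e unfolding W mfact_remove[OF e] by (simp add: count_eq_zero_iff)
    qed
    then have "(\<Sum>e\<in>set_mset B. ?p e) =
        process_const L R \<alpha> \<beta> t * ?W / (mfact B * ?Z) * real (\<Sum>e\<in>set_mset B. count B e)"
      by (simp add: sum_distrib_left)
    also have "(\<Sum>e\<in>set_mset B. count B e) = Suc t"
      using True by (simp add: size_multiset_overloaded_eq)
    finally show ?thesis
      using True sum by (simp add: const mult_ac)
  next
    case False
    \<comment> \<open>Either \<open>e\<close> lies outside \<open>L \<times> R\<close> and is never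
      sampled, or the predecessor already has the wrong size or a forbidden edge.\<close>
    have "?p e = 0" if e: "e \<in># B" for e
    proof (cases "e \<in> L \<times> R")
      case True
      have "\<not> (size (B - {#e#}) = t \<and> set_mset (B - {#e#}) \<subseteq> L \<times> R)"
      proof
        assume "size (B - {#e#}) = t \<and> set_mset (B - {#e#}) \<subseteq> L \<times> R"
        then have "size (add_mset e (B - {#e#})) = Suc t \<and> set_mset (add_mset e (B - {#e#})) \<subseteq> L \<times> R"
          using True by simp
        then show False
          using False e by simp
      qed
      then show ?thesis
        using Suc.IH[of "B - {#e#}"] ne by auto
    next
      case False
      then show ?thesis
        using pmf_edge_pmf[OF assms(1,2) ne assms(4,5)] by (cases e) auto
    qed
    then have "(\<Sum>e\<in>set_mset B. ?p e) = 0"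
      by (intro sum.neutral) blast
    then show ?thesis
      unfolding sum using False by (simp only: if_False)
  qed
qed

section \<open>Comparison with the configuration model\<close>

text \<open>Summing \<open>p = k * q\<close> over \<open>A\<close>, where \<open>q\<close> has all
  its mass, shows that the conditioning event has probability \<open>k\<close>. Dividing by
  \<open>k\<close> then gives \<open>q\<close> on \<open>A\<close>, and both laws vanish outside
  \<open>A\<close>.\<close>

lemma cond_pmf_eqI_proportional:
  assumes "set_pmf q \<subseteq> A" "k > 0" "\<And>x. x \<in> A \<Longrightarrow> pmf p x = k * pmf q x"
  shows "measure_pmf.prob p A = k" "cond_pmf p A = q"
proof -
  have "measure_pmf.prob p A = infsetsum (\<lambda>x. k * pmf q x) A"
    using assms(3) by (simp add: measure_pmf_conv_infsetsum cong: infsetsum_cong)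
  also have "\<dots> = k"
    by (simp add: infsetsum_cmult_right pmf_abs_summable infsetsum_pmf_eq_1[OF assms(1)])
  finally show k: "measure_pmf.prob p A = k" .
  \<comment> \<open>This is the condition under which \<open>cond_pmf\<close> is meaningful.\<close>
  then have "set_pmf p \<inter> A \<noteq> {}"
    using assms(2) measure_pmf_zero_iff[of p A] by (auto simp: Int_commute)
  then show "cond_pmf p A = q"
    using k assms by (intro pmf_eqI) (auto simp: pmf_cond pmf_eq_0_set_pmf)
qed

section \<open>Half-edges, degrees and perfect matchings\<close>

lemma finite_half_edges: "finite W \<Longrightarrow> finite (half_edges W d)"
  by (auto simp: half_edges_def)

lemma card_half_edges: "finite W \<Longrightarrow> card (half_edges W d) = (\<Sum>w\<in>W. d w)"
  by (simp add: half_edges_def)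

lemma count_half_edges:
  assumes "finite W"
  shows "count (image_mset fst (mset_set (half_edges W d))) w = (if w \<in> W then d w else 0)"
proof -
  have "count (image_mset fst (mset_set (half_edges W d))) w =
      (\<Sum>h | h \<in> half_edges W d \<and> w = fst h. 1)"
    using finite_half_edges[OF assms]
    unfolding count_image_mset' by (intro sum.cong) auto
  also have "\<dots> = card {h \<in> half_edges W d. w = fst h}"
    by simp
  also have "{h \<in> half_edges W d. w = fst h} = (if w \<in> W then Pair w ` {..<d w} else {})"
    by (auto simp: half_edges_def)
  also have "card \<dots> = (if w \<in> W then d w else 0)"
    by (simp add: card_image inj_on_def)
  finally show ?thesis .
qed

text \<open>Translates prescribed degrees into the marginal hypotheses of
  \<open>card_labelled_matchings\<close>. On the vertices of a part the counts are degrees;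
  elsewhere both sides count zero.\<close>

lemma has_bidegree_iff_marginals:
  assumes "finite L" "finite R" "L \<inter> R = {}" "set_mset B \<subseteq> L \<times> R"
  shows "has_bidegree L R dL dR B \<longleftrightarrow>
    image_mset fst B = image_mset fst (mset_set (half_edges L dL)) \<and>
    image_mset snd B = image_mset fst (mset_set (half_edges R dR))"
proof -
  have "image_mset fst B = image_mset fst (mset_set (half_edges L dL)) \<longleftrightarrow>
      (\<forall>u\<in>L. deg B u = dL u)"
  proof -
    have "count (image_mset fst B) u = 0" if "u \<notin> L" for u
      using that assms(4) by (auto simp: not_in_iff[symmetric])
    then show ?thesis
      using deg_left[OF assms(4,3)] by (auto simp: multiset_eq_iff count_half_edges[OF assms(1)])
  qed
  moreover have "image_mset snd B = image_mset fst (mset_set (half_edges R dR)) \<longleftrightarrow>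
      (\<forall>v\<in>R. deg B v = dR v)"
  proof -
    have "count (image_mset snd B) v = 0" if "v \<notin> R" for v
      using that assms(4) by (auto simp: not_in_iff[symmetric])
    then show ?thesis
      using deg_right[OF assms(4,3)] by (auto simp: multiset_eq_iff count_half_edges[OF assms(2)])
  qed
  ultimately show ?thesis
    by (simp add: has_bidegree_def)
qed

lemma perfect_matchings_finite_nonempty:
  assumes "finite HL" "finite HR" "card HL = card HR"
  shows "finite (perfect_matchings HL HR)" "perfect_matchings HL HR \<noteq> {}"
proof -
  show "finite (perfect_matchings HL HR)"
    unfolding perfect_matchings_def
    by (rule finite_subset[of _ "HL \<rightarrow>\<^sub>E HR"]) (use assms in \<open>auto intro: finite_PiE\<close>)
  obtain f where f: "bij_betw f HL HR"
    using finite_same_card_bij[OF assms] by blast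
  then have "restrict f HL \<in> perfect_matchings HL HR"
    by (auto simp: perfect_matchings_def bij_betw_def inj_on_def)
  then show "perfect_matchings HL HR \<noteq> {}" by blast
qed

lemma set_matching_graph:
  assumes "finite L" "f \<in> perfect_matchings (half_edges L dL) (half_edges R dR)"
  shows "set_mset (matching_graph (half_edges L dL) f) \<subseteq> L \<times> R"
proof -
  have "fst h \<in> L \<and> fst (f h) \<in> R" if h: "h \<in> half_edges L dL" for h
  proof -
    have "f h \<in> half_edges R dR"
      using assms(2) h by (auto simp: perfect_matchings_def)
    then show ?thesis
      using h by (auto simp: half_edges_def)
  qed
  then show ?thesis
    using finite_half_edges[OF assms(1), of dL] by (auto simp: matching_graph_def)
qed

lemma has_bidegree_matching_graph:
  assumes "finite L" "finite R" "L \<inter> R = {}"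
    and f: "f \<in> perfect_matchings (half_edges L dL) (half_edges R dR)"
  shows "has_bidegree L R dL dR (matching_graph (half_edges L dL) f)"
proof -
  have "image_mset snd (matching_graph (half_edges L dL) f) =
      image_mset fst (image_mset f (mset_set (half_edges L dL)))"
    by (simp add: matching_graph_def multiset.map_comp comp_def)
  also have "image_mset f (mset_set (half_edges L dL)) = mset_set (half_edges R dR)"
    using f by (auto simp: perfect_matchings_def bij_betw_def image_mset_mset_set)
  finally show ?thesis
    using has_bidegree_iff_marginals[OF assms(1-3) set_matching_graph[OF assms(1) f], of dL dR]
    by (simp add: matching_graph_def multiset.map_comp comp_def)
qed

section \<open>The law of the configuration model\<close>

context
  fixes L R :: "'v set" and dL dR :: "'v \<Rightarrow> nat"
  assumes fin: "finite L" "finite R" and disj: "L \<inter> R = {}"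
    and bidegree: "bidegree_seq L R dL dR"
begin

lemma half_edge_matchings_finite_nonempty:
  "finite (perfect_matchings (half_edges L dL) (half_edges R dR))"
  "perfect_matchings (half_edges L dL) (half_edges R dR) \<noteq> {}"
  using perfect_matchings_finite_nonempty[of "half_edges L dL" "half_edges R dR"] fin bidegree
  by (auto simp: finite_half_edges card_half_edges bidegree_seq_def)

lemma set_pmf_BCM:
  "set_pmf (BCM L R dL dR) =
    matching_graph (half_edges L dL) ` perfect_matchings (half_edges L dL) (half_edges R dR)"
  by (simp add: BCM_def half_edge_matchings_finite_nonempty)

lemma pmf_BCM:
  assumes "has_bidegree L R dL dR B" "set_mset B \<subseteq> L \<times> R"
  shows "pmf (BCM L R dL dR) B =
    mfact (image_mset fst (mset_set (half_edges L dL))) *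
    mfact (image_mset fst (mset_set (half_edges R dR))) /
    (real (card (perfect_matchings (half_edges L dL) (half_edges R dR))) * mfact B)"
proof -
  let ?HL = "half_edges L dL" and ?HR = "half_edges R dR"
  \<comment> \<open>The fibre of \<open>matching_graph\<close> over \<open>B\<close> is a set of
    labelled matchings, whose cardinality is known.\<close>
  have "perfect_matchings ?HL ?HR \<inter> matching_graph ?HL -` {B} =
      labelled_matchings fst fst ?HL ?HR B"
    by (auto simp: perfect_matchings_def labelled_matchings_def matching_graph_def)
  then have "pmf (BCM L R dL dR) B =
      real (card (labelled_matchings fst fst ?HL ?HR B)) / real (card (perfect_matchings ?HL ?HR))"
    using half_edge_matchings_finite_nonempty by (simp add: BCM_def pmf_map measure_pmf_of_set)
  then show ?thesis
    using has_bidegree_iff_marginals[OF fin disj assms(2), of dL dR] assms(1)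
      card_labelled_matchings[of ?HL ?HR B fst fst] fin
    by (simp add: finite_half_edges)
qed

end

theorem proposition2p2:
  fixes L R :: "'v set" and \<alpha> \<beta> :: real and t :: nat and dL dR :: "'v \<Rightarrow> nat"
  assumes "finite L" and "finite R" and "L \<inter> R = {}"
    and "\<alpha> > 0" and "\<beta> > 0"
    and "bidegree_seq L R dL dR" and "(\<Sum>u\<in>L. dL u) = t"
  shows "measure_pmf.prob (process_pmf L R \<alpha> \<beta> t) {B. has_bidegree L R dL dR B} > 0 \<and>
    cond_pmf (process_pmf L R \<alpha> \<beta> t) {B. has_bidegree L R dL dR B} = BCM L R dL dR"
proof -
  let ?HL = "half_edges L dL" and ?HR = "half_edges R dR"
  \<comment> \<open>If a part is empty, its degree sum is zero, and this sum equals
    \<open>t\<close>.\<close>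
  have ne: "t = 0 \<or> L \<noteq> {} \<and> R \<noteq> {}"
    using assms(6,7) by (auto simp: bidegree_seq_def)
  note setB = set_pmf_BCM[OF assms(1-3,6)]
  define N where "N = real (card (perfect_matchings ?HL ?HR))"
  define K where "K = mfact (image_mset fst (mset_set ?HL)) * mfact (image_mset fst (mset_set ?HR))"
  define c where "c = process_const L R \<alpha> \<beta> t * degree_weight L R \<alpha> \<beta> dL dR"
  have pos: "N > 0" "K > 0" "c > 0"
    using half_edge_matchings_finite_nonempty[OF assms(1-3,6)] assms ne
    by (auto simp: N_def K_def c_def card_gt_0_iff mfact_pos process_const_pos degree_weight_pos)
  \<comment> \<open>For \<open>B\<close> inside \<open>L \<times> R\<close> the two laws are
    \<open>c / mfact B\<close> and \<open>K / (N * mfact B)\<close>, so their ratio is the same for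
    all such \<open>B\<close>.\<close>
  have "pmf (process_pmf L R \<alpha> \<beta> t) B = c * N / K * pmf (BCM L R dL dR) B"
    if B: "has_bidegree L R dL dR B" for B
  proof (cases "set_mset B \<subseteq> L \<times> R")
    case True
    have "size B = (\<Sum>u\<in>L. dL u)"
      using sum_deg_left[OF assms(1) True assms(3)] B by (simp add: has_bidegree_def)
    moreover have "degree_weight L R \<alpha> \<beta> (deg B) (deg B) = degree_weight L R \<alpha> \<beta> dL dR"
      using B by (simp add: degree_weight_def has_bidegree_def)
    ultimately have "pmf (process_pmf L R \<alpha> \<beta> t) B = c / mfact B"
      using pmf_process[OF assms(1-5) ne, of B] True assms(7) by (simp add: c_def)
    moreover have "pmf (BCM L R dL dR) B = K / (N * mfact B)"
      using pmf_BCM[OF assms(1-3,6) B True] by (simp add: K_def N_def)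
    ultimately show ?thesis
      using pos by simp
  next
    \<comment> \<open>\<open>has_bidegree\<close> only constrains degrees, so it also admits
      multigraphs with edges outside \<open>L \<times> R\<close>; both laws give them probability
      zero.\<close>
    case False
    then have "B \<notin> set_pmf (BCM L R dL dR)"
      unfolding setB using set_matching_graph[OF assms(1)] by blast
    then have "pmf (BCM L R dL dR) B = 0"
      by (simp add: pmf_eq_0_set_pmf)
    then show ?thesis
      using False pmf_process[OF assms(1-5) ne, of B] by simp
  qed
  moreover have "set_pmf (BCM L R dL dR) \<subseteq> {B. has_bidegree L R dL dR B}"
    using setB has_bidegree_matching_graph[OF assms(1-3)] by auto
  moreover have "c * N / K > 0"
    using pos by simp
  ultimately show ?thesis
    using cond_pmf_eqI_proportional[of "BCM L R dL dR" "{B. has_bidegree L R dL dR B}" "c * N / K"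
        "process_pmf L R \<alpha> \<beta> t"]
    by simp
qed

end
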